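(* For $x=\begin{pmatrix} x_1 & 0 & x_4 \\ 0 & x_2 & x_5 \\ x_4 & x_5 & x_3 \end{pmatrix}\in\Omega$ set $S(x)=x_3-\frac{x_4^2}{x_1}-\frac{x_5^2}{x_2}>0$, $a_1=\sqrt{x_1}$, $a_2=\sqrt{x_2}$, $a_3=\sqrt{S(x)}$. Then $\mathrm{Log}_\Delta(x)=(v_1,\dots,v_5)\in V$ is given by $v_1=\log x_1$, $v_2=\log x_2$, $v_3=\log S(x)$, $$v_4=\begin{cases} \dfrac{x_4}{\sqrt{x_1}}\dfrac{\log(a_1/a_3)}{a_1-a_3}, & a_1\ne a_3, \\[1ex] \dfrac{x_4}{x_1}, & a_1=a_3, \end{cases}\qquad v_5=\begin{cases} \dfrac{x_5}{\sqrt{x_2}}\dfrac{\log(a_2/a_3)}{a_2-a_3}, & a_2\ne a_3, \\[1ex] \dfrac{x_5}{x_2}, & a_2=a_3. \end{cases}$$ Conversely, if $v=(v_1,\dots,v_5)\in V$, define $a_i=e^{v_i/2}$ for $i=1,2,3$, $$b_4=\begin{cases} 2v_4\dfrac{a_1-a_3}{v_1-v_3}, & v_1\ne v_3, \\[1ex] v_4a_1, & v_1=v_3, \end{cases}\qquad b_5=\begin{cases} 2v_5\dfrac{a_2-a_3}{v_2-v_3}, & v_2\ne v_3, \\[1ex] v_5a_2, & v_2=v_3. \end{cases}$$ Then $$\mathrm{Exp}_\Delta(v)=\begin{pmatrix} a_1^2 & 0 & a_1b_4 \\ 0 & a_2^2 & a_2b_5 \\ a_1b_4 & a_2b_5 &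 b_4^2+b_5^2+a_3^2 \end{pmatrix}.$$
   Context: Let $V\subset \mathrm{Sym}(3,\mathbb{R})$ be the 5-dimensional space of matrices $\begin{pmatrix} v_1 & 0 & v_4 \\ 0 & v_2 & v_5 \\ v_4 & v_5 & v_3 \end{pmatrix}$, also written $(v_1,v_2,v_3,v_4,v_5)$, and let $\Omega\subset V$ be the open cone of positive definite matrices in $V$. Let $H$ be the group of real lower triangular $3\times 3$ matrices with positive diagonal entries and zero $(2,1)$ entry; each $x\in\Omega$ has a unique Cholesky factor $T_x\in H$ with $x=T_xT_x^{\top}$. For $v\in V$ let $\underline{v}$ be the unique lower triangular matrix with $v=\underline v+\underline v^{\top}$. The clan exponential is $\mathrm{Exp}_\Delta:V\to\Omega$, $\mathrm{Exp}_\Delta(v)=\exp(\underline v)\exp(\underline v)^{\top}$, a diffeomorphism with inverse the clan logarithm $\mathrm{Log}_\Delta(x)=\log(T_x)+\log(T_x)^{\top}$ (principal matrix logarithm). *)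

theory Defs
  imports "HOL-Analysis.Analysis"
begin

section \<open>Exponential and principal logarithm of real square matrices\<close>

text \<open>
  Matrices are elements of \<open>real ^ 'n ^ 'n\<close> (a vector of rows) with product \<open>**\<close>.  The class
  operations \<open>*\<close>, \<open>^\<close> and \<open>1\<close> are componentwise on this type and are not used.
\<close>

definition matrix_power :: "real ^ 'n ^ 'n \<Rightarrow> nat \<Rightarrow> real ^ 'n ^ 'n" where
  "matrix_power A k = (((**) A) ^^ k) (mat 1)"

definition matrix_exp :: "real ^ 'n ^ 'n \<Rightarrow> real ^ 'n ^ 'n" where
  "matrix_exp A = (\<Sum>k. matrix_power A k /\<^sub>R fact k)"

definition complex_eigenvalue :: "real ^ 'n ^ 'n \<Rightarrow> complex \<Rightarrow> bool" where
  "complex_eigenvalue A z \<longleftrightarrow>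
     (\<exists>u :: complex ^ 'n. u \<noteq> 0 \<and> map_matrix complex_of_real A *v u = z *s u)"

text \<open>
  For a matrix \<open>A\<close> without eigenvalues in \<open>{..0}\<close>, the principal logarithm is the unique \<open>X\<close> with
  \<open>exp X = A\<close> whose eigenvalues all lie in the open strip of imaginary parts between \<open>-\<pi>\<close> and \<open>\<pi>\<close>.
  For real \<open>A\<close> this \<open>X\<close> is real, so it suffices to let \<open>X\<close> range over the real matrices.
\<close>

definition matrix_log :: "real ^ 'n ^ 'n \<Rightarrow> real ^ 'n ^ 'n" where
  "matrix_log A =
     (THE X. matrix_exp X = A \<and> (\<forall>z. complex_eigenvalue X z \<longrightarrow> - pi < Im z \<and> Im z < pi))"

section \<open>The cone, its Cholesky factors, and the clan exponential and logarithm\<close>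

definition V_mat :: "real \<Rightarrow> real \<Rightarrow> real \<Rightarrow> real \<Rightarrow> real \<Rightarrow> real ^ 3 ^ 3" where
  "V_mat v1 v2 v3 v4 v5 =
     vector [vector [v1, 0, v4],
             vector [0, v2, v5],
             vector [v4, v5, v3]]"

definition V_space :: "(real ^ 3 ^ 3) set" where
  "V_space = {V_mat v1 v2 v3 v4 v5 | v1 v2 v3 v4 v5. True}"

definition pos_def_matrix :: "real ^ 'n ^ 'n \<Rightarrow> bool" where
  "pos_def_matrix A \<longleftrightarrow> transpose A = A \<and> (\<forall>u. u \<noteq> 0 \<longrightarrow> u \<bullet> (A *v u) > 0)"

definition Omega :: "(real ^ 3 ^ 3) set" where
  "Omega = {x \<in> V_space. pos_def_matrix x}"

text \<open>
  Entries are listed explicitly because the order on the index type \<open>3\<close> is not the usual one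
  (there \<open>3 = 0\<close> is the least element).
\<close>

definition lower_triangular :: "real ^ 3 ^ 3 \<Rightarrow> bool" where
  "lower_triangular L \<longleftrightarrow> L $ 1 $ 2 = 0 \<and> L $ 1 $ 3 = 0 \<and> L $ 2 $ 3 = 0"

definition H_group :: "(real ^ 3 ^ 3) set" where
  "H_group = {T. lower_triangular T \<and> (\<forall>i. T $ i $ i > 0) \<and> T $ 2 $ 1 = 0}"

definition cholesky :: "real ^ 3 ^ 3 \<Rightarrow> real ^ 3 ^ 3" where
  "cholesky x = (THE T. T \<in> H_group \<and> x = T ** transpose T)"

definition lower_part :: "real ^ 3 ^ 3 \<Rightarrow> real ^ 3 ^ 3" where
  "lower_part v = (THE L. lower_triangular L \<and> v = L + transpose L)"

definition clan_Exp :: "real ^ 3 ^ 3 \<Rightarrow> real ^ 3 ^ 3" where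
  "clan_Exp v = matrix_exp (lower_part v) ** transpose (matrix_exp (lower_part v))"

definition clan_Log :: "real ^ 3 ^ 3 \<Rightarrow> real ^ 3 ^ 3" where
  "clan_Log x = matrix_log (cholesky x) + transpose (matrix_log (cholesky x))"

end

theory Submission
  imports Defs "HOL-Computational_Algebra.Fundamental_Theorem_Algebra"
begin

text \<open>
  A lower triangular matrix \<open>L\<close> with vanishing \<open>(2, 1)\<close> entry has generalized eigenvectors of index
  at most two that span the space.  If \<open>L u = l u + w\<close> and \<open>L w = l w\<close>, then
  \<open>exp L u = e\<^sup>l (u + w)\<close>, which gives \<open>exp L\<close> in closed form.

  The logarithm of \<open>exp L\<close> is unique among all real \<open>X\<close> whose eigenvalues lie in the strip.  Let
  \<open>exp X u = e\<^sup>l u\<close>.  Some complex polynomial in \<open>X\<close> annihilates \<open>u\<close>; stripping off its linear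
  factors one at a time yields \<open>X u = l u\<close>: on the eigenspace of \<open>exp X\<close>, eigenvalues of \<open>X\<close> other
  than \<open>l\<close> are excluded by injectivity of \<open>exp\<close> on the strip, and a vector of index two is excluded by
  \<open>exp X u = e\<^sup>l (u + (X - l) u)\<close>.  In index two, \<open>w\<close> and \<open>(X - l) u\<close> are both eigenvectors of
  \<open>exp X\<close>, hence of \<open>X\<close>, and comparing the two expressions for \<open>exp X u\<close> gives \<open>X u = L u\<close>.
\<close>

section \<open>The matrix exponential\<close>

lemma matrix_power_0 [simp]: "matrix_power A 0 = mat 1"
  by (simp add: matrix_power_def)

lemma matrix_power_Suc [simp]: "matrix_power A (Suc k) = A ** matrix_power A k"
  by (simp add: matrix_power_def)

lemma matrix_power_commute: "matrix_power A k ** A = A ** matrix_power A k"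
  by (induction k) (simp_all add: matrix_mul_assoc [symmetric])

text \<open>Each product adds \<open>CARD('n)\<close> terms, so the powers are dominated entrywise
  by those of one scalar and the exponential series by a scalar one.\<close>

lemma matrix_power_entry_bound:
  fixes A :: "real ^ 'n ^ 'n"
  assumes "\<And>i j. \<bar>A $ i $ j\<bar> \<le> c" and "0 \<le> c"
  shows "\<bar>matrix_power A k $ i $ j\<bar> \<le> (real CARD('n) * c) ^ k"
proof (induction k arbitrary: i j)
  case 0
  then show ?case by (simp add: mat_def)
next
  case (Suc k)
  have "\<bar>matrix_power A (Suc k) $ i $ j\<bar> \<le> (\<Sum>l\<in>UNIV. \<bar>A $ i $ l * matrix_power A k $ l $ j\<bar>)"
    by (simp add: matrix_matrix_mult_def sum_abs)
  also have "\<dots> \<le> (\<Sum>l\<in>(UNIV :: 'n set). c * (real CARD('n) * c) ^ k)"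
    using Suc assms by (intro sum_mono) (simp add: abs_mult mult_mono)
  also have "\<dots> = (real CARD('n) * c) ^ Suc k"
    by simp
  finally show ?case .
qed

lemma matrix_exp_sums: "(\<lambda>k. matrix_power A k /\<^sub>R fact k) sums matrix_exp A"
proof -
  define c where "c = Max (range (\<lambda>(i, j). \<bar>A $ i $ j\<bar>))"
  have c: "\<bar>A $ i $ j\<bar> \<le> c" for i j
    unfolding c_def by (intro Max_ge) (auto intro!: image_eqI[of _ _ "(i, j)"])
  have c0: "0 \<le> c"
    using c[of undefined undefined] by linarith
  define d where "d = real CARD('a) * c"
  have "norm (matrix_power A k) \<le> (\<Sum>i\<in>(UNIV :: 'a set). \<Sum>j\<in>(UNIV :: 'a set). d ^ k)" for k
  proof -
    have "norm (matrix_power A k) \<le> (\<Sum>i\<in>UNIV. norm (matrix_power A k $ i))"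
      by (simp add: norm_vec_def L2_set_le_sum)
    also have "\<dots> \<le> (\<Sum>i\<in>UNIV. \<Sum>j\<in>UNIV. \<bar>matrix_power A k $ i $ j\<bar>)"
      by (intro sum_mono norm_le_l1_cart)
    also have "\<dots> \<le> (\<Sum>i\<in>(UNIV :: 'a set). \<Sum>j\<in>(UNIV :: 'a set). d ^ k)"
      unfolding d_def by (intro sum_mono matrix_power_entry_bound c c0)
    finally show ?thesis .
  qed
  then have "norm (matrix_power A k /\<^sub>R fact k) \<le> (real CARD('a))\<^sup>2 * (d ^ k /\<^sub>R fact k)" for k
    using mult_left_mono[of _ _ "inverse (fact k)"] by (simp add: power2_eq_square ac_simps)
  moreover have "summable (\<lambda>k. (real CARD('a))\<^sup>2 * (d ^ k /\<^sub>R fact k))"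
    by (intro summable_mult summable_exp_generic)
  ultimately have "summable (\<lambda>k. matrix_power A k /\<^sub>R fact k)"
    by (blast intro: summable_comparison_test'[where N = 0])
  then show ?thesis
    unfolding matrix_exp_def by (rule summable_sums)
qed

text \<open>Multiplication by \<open>A\<close> on either side is bounded linear and passes through
  the series. It makes the eigenspaces of \<open>matrix_exp A\<close> invariant under
  \<open>A\<close>.\<close>

lemma matrix_exp_commute: "A ** matrix_exp A = matrix_exp A ** A"
proof -
  have "(\<lambda>k. A ** (matrix_power A k /\<^sub>R fact k)) sums (A ** matrix_exp A)"
    by (rule bounded_linear.sums[OF _ matrix_exp_sums])
      (intro linear_conv_bounded_linear[THEN iffD1] linearI,
        simp_all add: matrix_add_ldistrib matrix_scalar_ac scalar_matrix_assoc)
  moreover have "(\<lambda>k. (matrix_power A k /\<^sub>R fact k) ** A) sums (matrix_exp A ** A)"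
    by (rule bounded_linear.sums[OF _ matrix_exp_sums])
      (intro linear_conv_bounded_linear[THEN iffD1] linearI,
        simp_all add: matrix_matrix_mult_def vec_eq_iff sum.distrib sum_distrib_left
          distrib_right mult.assoc)
  moreover have "(matrix_power A k /\<^sub>R fact k) ** A = A ** (matrix_power A k /\<^sub>R fact k)" for k
    by (simp add: matrix_power_commute matrix_scalar_ac flip: scalar_matrix_assoc)
  ultimately show ?thesis
    by (metis (no_types, lifting) sums_unique2 sums_cong)
qed

lemma map_matrix_of_real_mult:
  fixes A B :: "real ^ 'n ^ 'n" and u :: "'a :: real_algebra_1 ^ 'n"
  shows "map_matrix of_real (A ** B) *v u = map_matrix of_real A *v (map_matrix of_real B *v u)"
proof -
  have "(map_matrix of_real (A ** B) :: 'a ^ 'n ^ 'n) = map_matrix of_real A ** map_matrix of_real B"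
    by (simp add: matrix_matrix_mult_def vec_eq_iff)
  then show ?thesis
    by (simp add: matrix_vector_mul_assoc)
qed

lemma map_matrix_of_real_mat_1 [simp]: "map_matrix of_real (mat 1) = mat 1"
  by (simp add: mat_def vec_eq_iff)

text \<open>This is the binomial expansion of \<open>(z + N)^k\<close> for \<open>N u = w\<close>
  and \<open>N w = 0\<close>. The scalar field is left open: real for the closed form, complex for
  uniqueness.\<close>

lemma matrix_power_generalized_eigenvector:
  fixes A :: "real ^ 'n ^ 'n" and u w :: "'a :: real_normed_field ^ 'n"
  assumes "map_matrix of_real A *v u = z *s u + w" and "map_matrix of_real A *v w = z *s w"
  shows "map_matrix of_real (matrix_power A k) *v u = z ^ k *s u + (of_nat k * z ^ (k - 1)) *s w"
proof (induction k)
  case 0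
  then show ?case by simp
next
  case (Suc k)
  \<comment> \<open>Truncated subtraction breaks the equation at \<open>k = 0\<close>, where the
    factor \<open>of_nat k\<close> removes the term anyway.\<close>
  have "k = 0 \<or> z * z ^ (k - Suc 0) = z ^ k"
    by (cases k) simp_all
  then show ?case
    using assms
    by (auto simp: map_matrix_of_real_mult Suc matrix_vector_right_distrib vector_scalar_commute
        vec_eq_iff algebra_simps)
qed

lemma matrix_exp_generalized_eigenvector:
  fixes A :: "real ^ 'n ^ 'n" and u w :: "'a :: {real_normed_field, banach} ^ 'n"
  assumes "map_matrix of_real A *v u = z *s u + w" and "map_matrix of_real A *v w = z *s w"
  shows "map_matrix of_real (matrix_exp A) *v u = exp z *s (u + w)"
proof (rule vec_eq_iff[THEN iffD2, rule_format])
  fix i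
  have "(\<lambda>k. (matrix_power A k /\<^sub>R fact k) $ i $ j) sums (matrix_exp A $ i $ j)" for j
    by (intro bounded_linear.sums[OF bounded_linear_vec_nth] matrix_exp_sums)
  then have "(\<lambda>k. \<Sum>j\<in>UNIV. of_real ((matrix_power A k /\<^sub>R fact k) $ i $ j) * u $ j)
      sums (\<Sum>j\<in>UNIV. of_real (matrix_exp A $ i $ j) * u $ j)"
    by (intro sums_sum sums_mult2 sums_of_real)
  moreover have "(\<Sum>j\<in>UNIV. of_real ((matrix_power A k /\<^sub>R fact k) $ i $ j) * u $ j)
      = (z ^ k /\<^sub>R fact k) * u $ i + ((of_nat k * z ^ (k - 1)) /\<^sub>R fact k) * w $ i" for k
  proof -
    have "(\<Sum>j\<in>UNIV. of_real ((matrix_power A k /\<^sub>R fact k) $ i $ j) * u $ j)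
        = (map_matrix of_real (matrix_power A k) *v u) $ i /\<^sub>R fact k"
      by (simp add: matrix_vector_mult_def scaleR_conv_of_real[where 'a = 'a]
          sum_distrib_left mult.assoc)
    then show ?thesis
      by (simp add: matrix_power_generalized_eigenvector[OF assms] scaleR_right_distrib)
  qed
  moreover have "(\<lambda>k. (z ^ k /\<^sub>R fact k) * u $ i + ((of_nat k * z ^ (k - 1)) /\<^sub>R fact k) * w $ i)
      sums (exp z * u $ i + exp z * w $ i)"
  proof (intro sums_add sums_mult2)
    show "(\<lambda>k. z ^ k /\<^sub>R fact k) sums exp z"
      by (rule exp_converges)
    \<comment> \<open>The coefficient series of \<open>w\<close> is the exponential series shifted
      by one index, with a zero in front.\<close>
    have "(of_nat (Suc k) * z ^ (Suc k - 1)) /\<^sub>R fact (Suc k) = z ^ k /\<^sub>R fact k" for k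
      by (simp add: scaleR_conv_of_real field_simps del: of_nat_Suc)
    then have "(\<lambda>k. (of_nat (Suc k) * z ^ (Suc k - 1)) /\<^sub>R fact (Suc k)) sums exp z"
      using exp_converges[of z] by simp
    from sums_Suc[OF this] show "(\<lambda>k. (of_nat k * z ^ (k - 1)) /\<^sub>R fact k) sums exp z"
      by simp
  qed
  ultimately have "(\<Sum>j\<in>UNIV. of_real (matrix_exp A $ i $ j) * u $ j) = exp z * u $ i + exp z * w $ i"
    by (simp add: sums_unique2)
  then show "(map_matrix of_real (matrix_exp A) *v u) $ i = (exp z *s (u + w)) $ i"
    by (simp add: matrix_vector_mult_def algebra_simps)
qed

section \<open>Uniqueness of the principal logarithm\<close>

text \<open>This is \<open>p(M) u\<close> by Horner's scheme. Acting on vectors sidesteps the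
  componentwise ring operations on matrices.\<close>

definition poly_act :: "'a :: field ^ 'n ^ 'n \<Rightarrow> 'a poly \<Rightarrow> 'a ^ 'n \<Rightarrow> 'a ^ 'n" where
  "poly_act M p u = fold_coeffs (\<lambda>c w. c *s u + M *v w) p 0"

lemma poly_act_0 [simp]: "poly_act M 0 u = 0"
  by (simp add: poly_act_def)

lemma poly_act_pCons [simp]: "poly_act M (pCons c p) u = c *s u + M *v poly_act M p u"
  by (cases "p = 0 \<and> c = 0") (auto simp: poly_act_def)

lemma poly_act_add: "poly_act M (p + q) u = poly_act M p u + poly_act M q u"
  by (induction p q rule: poly_induct2)
    (simp_all add: matrix_vector_right_distrib algebra_simps)

lemma poly_act_smult: "poly_act M (smult c p) u = c *s poly_act M p u"
  by (induction p) (simp_all add: vector_scalar_commute vector_add_ldistrib)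

lemma poly_act_add_vector: "poly_act M p (u + w) = poly_act M p u + poly_act M p w"
  by (induction p) (simp_all add: matrix_vector_right_distrib algebra_simps)

lemma poly_act_smult_vector: "poly_act M p (c *s u) = c *s poly_act M p u"
  by (induction p) (simp_all add: vector_scalar_commute vector_add_ldistrib mult.commute)

lemma poly_act_mult_vector: "poly_act M p (M *v u) = M *v poly_act M p u"
  by (induction p) (simp_all add: matrix_vector_right_distrib vector_scalar_commute)

lemma poly_act_linear_mult:
  "poly_act M ([:- m, 1:] * q) u = poly_act M q (M *v u - m *s u)"
proof -
  have "M *v u - m *s u = M *v u + (- m) *s u"
    by (simp add: vec_eq_iff)
  moreover have "[:- m, 1:] * q = pCons 0 q + smult (- m) q"
    by simp
  ultimately show ?thesis
    by (simp only: poly_act_add poly_act_smult poly_act_add_vector poly_act_smult_vector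
        poly_act_mult_vector poly_act_pCons) simp
qed

lemma poly_act_monom: "poly_act M (monom c k) u = c *s ((*v) M ^^ k) u"
  by (induction k) (simp_all add: monom_0 monom_Suc vector_scalar_commute)

lemma poly_act_sum: "poly_act M (sum f S) u = (\<Sum>x\<in>S. poly_act M (f x) u)"
  by (induction S rule: infinite_finite_induct) (simp_all add: poly_act_add)

text \<open>The iterates of \<open>u\<close> under \<open>M\<close> live in a finite-dimensional
  space; a linear relation among them is the polynomial.\<close>

lemma exists_annihilating_poly:
  fixes M :: "'a :: field ^ 'n ^ 'n"
  obtains p where "p \<noteq> 0" and "poly_act M p u = 0"
proof (cases "inj (\<lambda>k. ((*v) M ^^ k) u)")
  case True
  let ?g = "\<lambda>k. ((*v) M ^^ k) u"
  have "vec.dependent (range ?g)"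
    using vec.independent_bound_general True finite_imageD by blast
  then obtain t c where t: "finite t" "t \<subseteq> range ?g" "(\<Sum>v\<in>t. c v *s v) = 0" "\<exists>v\<in>t. c v \<noteq> 0"
    by (auto simp: vec.dependent_explicit)
  define S where "S = ?g -` t"
  have t_eq: "t = ?g ` S"
    using t(2) by (auto simp: S_def)
  have S: "finite S"
    unfolding S_def using t(1) True by (rule finite_vimageI)
  define p where "p = (\<Sum>k\<in>S. monom (c (?g k)) k)"
  have "(\<Sum>v\<in>t. c v *s v) = (\<Sum>k\<in>S. c (?g k) *s ?g k)"
    unfolding t_eq using True by (subst sum.reindex) (auto intro: inj_on_subset)
  then have "poly_act M p u = 0"
    using t(3) by (simp add: p_def poly_act_sum poly_act_monom)
  moreover from t(4) obtain k where k: "k \<in> S" "c (?g k) \<noteq> 0"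
    unfolding t_eq by blast
  have "coeff p k = c (?g k)"
    using S k(1) by (simp add: p_def coeff_sum)
  then have "p \<noteq> 0"
    using k(2) by auto
  ultimately show ?thesis
    using that by blast
next
  case False
  \<comment> \<open>The set of iterates may now be independent, so the repetition itself supplies
    the relation.\<close>
  then obtain i j where ij: "i \<noteq> j" "((*v) M ^^ i) u = ((*v) M ^^ j) u"
    by (auto simp: inj_def)
  let ?p = "monom 1 i + monom (- 1) j :: 'a poly"
  have "poly_act M ?p u = 0"
    using ij by (simp add: poly_act_add poly_act_monom vec_eq_iff)
  moreover have "coeff ?p i \<noteq> 0"
    using ij by simp
  then have "?p \<noteq> 0"
    by (metis coeff_0)
  ultimately show ?thesis
    using that by blast
qed

lemma eigenvector_of_matrix_exp:
  fixes X :: "real ^ 'n ^ 'n"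
  assumes strip: "\<forall>z. complex_eigenvalue X z \<longrightarrow> - pi < Im z \<and> Im z < pi"
    and l: "- pi < Im l" "Im l < pi"
    and u: "map_matrix complex_of_real (matrix_exp X) *v u = exp l *s u"
  shows "map_matrix complex_of_real X *v u = l *s u"
proof -
  let ?X = "map_matrix complex_of_real X" and ?T = "map_matrix complex_of_real (matrix_exp X)"
  have commute: "?T *v (?X *v v) = ?X *v (?T *v v)" for v
    by (metis map_matrix_of_real_mult matrix_exp_commute)
  have *: "?X *v u = l *s u" if "p \<noteq> 0" "poly_act ?X p u = 0" "?T *v u = exp l *s u" for p u
    using that
  proof (induction "degree p" arbitrary: p u)
    case 0
    then obtain c where "p = [:c:]"
      by (metis degree_0_id)
    with 0 show ?case by simp
  next
    case (Suc d)
    then obtain m where "poly p m = 0"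
      using alg_closed_imp_poly_has_root[of p] by auto
    then obtain q where q: "p = [:- m, 1:] * q"
      by (auto simp: poly_eq_0_iff_dvd)
    let ?w = "?X *v u - m *s u" and ?u' = "?X *v u - l *s u"
    \<comment> \<open>The vector \<open>?w\<close> is annihilated by the shorter \<open>q\<close>
      and stays in the eigenspace of \<open>?T\<close>, which commutes with
      \<open>?X\<close>.\<close>
    have "?X *v ?w = l *s ?w"
    proof (rule Suc.hyps(1)[of q])
      show "q \<noteq> 0" using q Suc.prems by auto
      then have "degree p = Suc (degree q)"
        unfolding q by (subst degree_mult_eq) auto
      then show "d = degree q" using Suc.hyps by simp
      show "poly_act ?X q ?w = 0"
        using Suc.prems(2) unfolding q poly_act_linear_mult .
      show "?T *v ?w = exp l *s ?w"
        by (simp add: matrix_vector_mult_diff_distrib commute Suc.prems vector_scalar_commute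
            vector_sub_rdistrib vec_eq_iff algebra_simps)
    qed
    \<comment> \<open>The factors of \<open>(X - l) (X - m) u = 0\<close> are exchanged.\<close>
    then have u': "?X *v ?u' = m *s ?u'"
      by (simp add: matrix_vector_mult_diff_distrib vector_scalar_commute vec_eq_iff algebra_simps)
    show ?case
    proof (cases "?u' = 0")
      case True
      then show ?thesis by simp
    next
      case False
      then have "complex_eigenvalue X m"
        unfolding complex_eigenvalue_def using u' by blast
      have "?T *v ?u' = exp m *s (?u' + 0)"
        by (rule matrix_exp_generalized_eigenvector) (simp_all add: u')
      moreover have "?T *v ?u' = exp l *s ?u'"
        by (simp add: matrix_vector_mult_diff_distrib commute Suc.prems vector_scalar_commute
            vec_eq_iff algebra_simps)
      ultimately have "exp m *s ?u' = exp l *s ?u'"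
        by (simp only: add_0_right)
      then have "exp m = exp l"
        using False by (simp only: vector_mul_rcancel) simp
      moreover have "\<bar>Im m - Im l\<bar> < 2 * pi"
        using strip \<open>complex_eigenvalue X m\<close> l by fastforce
      ultimately have "m = l"
        by (rule exp_complex_eqI[rotated])
      have "?T *v u = exp l *s (u + ?u')"
        by (rule matrix_exp_generalized_eigenvector) (use u' \<open>m = l\<close> in simp_all)
      with Suc.prems(3) have "exp l *s u = exp l *s (u + ?u')"
        by (simp only:)
      then have "u = u + ?u'"
        by (simp only: vector_mul_lcancel) simp
      then show ?thesis
        by simp
    qed
  qed
  show ?thesis
    using exists_annihilating_poly * u by metis
qed

lemma generalized_eigenvector_of_matrix_exp:
  fixes X L :: "real ^ 'n ^ 'n"
  assumes strip: "\<forall>z. complex_eigenvalue X z \<longrightarrow> - pi < Im z \<and> Im z < pi"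
    and l: "- pi < Im l" "Im l < pi"
    and exp_eq: "matrix_exp X = matrix_exp L"
    and u: "map_matrix complex_of_real L *v u = l *s u + w"
    and w: "map_matrix complex_of_real L *v w = l *s w"
  shows "map_matrix complex_of_real X *v u = l *s u + w"
proof -
  let ?X = "map_matrix complex_of_real X" and ?T = "map_matrix complex_of_real (matrix_exp X)"
  let ?y = "?X *v u - l *s u"
  have commute: "?T *v (?X *v v) = ?X *v (?T *v v)" for v
    by (metis map_matrix_of_real_mult matrix_exp_commute)
  have Tu: "?T *v u = exp l *s (u + w)"
    unfolding exp_eq by (rule matrix_exp_generalized_eigenvector[OF u w])
  have "?T *v w = exp l *s (w + 0)"
    unfolding exp_eq by (rule matrix_exp_generalized_eigenvector) (simp_all add: w)
  then have Xw: "?X *v w = l *s w"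
    using eigenvector_of_matrix_exp[OF strip l] by simp
  \<comment> \<open>Since \<open>?T\<close> commutes with \<open>X - l\<close>, the left side is
    \<open>exp l\<close> times \<open>(X - l) (u + w)\<close>, and
    \<open>(X - l) w = 0\<close>.\<close>
  have "?T *v ?y = exp l *s ?y"
    by (simp add: matrix_vector_mult_diff_distrib commute Tu Xw vector_scalar_commute
        matrix_vector_right_distrib vec_eq_iff algebra_simps)
  then have "?X *v ?y = l *s ?y"
    by (rule eigenvector_of_matrix_exp[OF strip l])
  then have "?T *v u = exp l *s (u + ?y)"
    by (intro matrix_exp_generalized_eigenvector) simp_all
  with Tu have "exp l *s (u + w) = exp l *s (u + ?y)"
    by (simp only:)
  then have "u + w = u + ?y"
    by (simp only: vector_mul_lcancel) simp
  then show ?thesis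
    by (simp add: algebra_simps)
qed

section \<open>The clan exponential and logarithm\<close>

text \<open>These matrices form the Lie algebra of \<open>H_group\<close>; lower parts, their
  exponentials and Cholesky factors all have this shape.\<close>

definition arrow_mat :: "real \<Rightarrow> real \<Rightarrow> real \<Rightarrow> real \<Rightarrow> real \<Rightarrow> real ^ 3 ^ 3" where
  "arrow_mat l1 l2 l3 m4 m5 = vector [vector [l1, 0, 0], vector [0, l2, 0], vector [m4, m5, l3]]"

lemmas mat3_simps = vec_eq_iff forall_3 sum_3 vector_3 matrix_matrix_mult_def
  matrix_vector_mult_def transpose_def axis_def

lemma complex_eigenvalue_arrow_mat:
  assumes "complex_eigenvalue (arrow_mat l1 l2 l3 m4 m5) z"
  shows "Im z = 0"
proof -
  obtain u :: "complex ^ 3" where u: "u \<noteq> 0"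
    and eq: "map_matrix complex_of_real (arrow_mat l1 l2 l3 m4 m5) *v u = z *s u"
    using assms unfolding complex_eigenvalue_def by blast
  have "complex_of_real l1 * u $ 1 = z * u $ 1" "complex_of_real l2 * u $ 2 = z * u $ 2"
    "complex_of_real m4 * u $ 1 + complex_of_real m5 * u $ 2 + complex_of_real l3 * u $ 3 = z * u $ 3"
    using eq by (simp_all add: mat3_simps arrow_mat_def)
  moreover have "u $ 1 \<noteq> 0 \<or> u $ 2 \<noteq> 0 \<or> u $ 3 \<noteq> 0"
    using u by (auto simp: mat3_simps)
  ultimately have "z = complex_of_real l1 \<or> z = complex_of_real l2 \<or> z = complex_of_real l3"
    by (cases "u $ 1 = 0"; cases "u $ 2 = 0") auto
  then show ?thesis
    by auto
qed

text \<open>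
  The generalized eigenvectors \<open>e\<^sub>3\<close> and \<open>e\<^sub>i + c e\<^sub>3\<close> (\<open>i = 1, 2\<close>) span the space; the correction
  \<open>c = m / (l\<^sub>i - l\<^sub>3)\<close> is \<open>0\<close> by the convention on division in the resonant case \<open>l\<^sub>i = l\<^sub>3\<close>, where
  \<open>e\<^sub>i\<close> has generalized index two.
\<close>

lemma arrow_mat_generalized_eigenvectors:
  fixes l1 l2 l3 m4 m5 :: real
  defines "M \<equiv> map_matrix of_real (arrow_mat l1 l2 l3 m4 m5) :: 'a :: real_normed_field ^ 3 ^ 3"
  shows "M *v axis 3 c = of_real l3 *s axis 3 c"
    and "M *v (axis 1 1 + axis 3 (of_real (m4 / (l1 - l3)))) =
      of_real l1 *s (axis 1 1 + axis 3 (of_real (m4 / (l1 - l3))))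
        + axis 3 (of_real (if l1 = l3 then m4 else 0))"
    and "M *v (axis 2 1 + axis 3 (of_real (m5 / (l2 - l3)))) =
      of_real l2 *s (axis 2 1 + axis 3 (of_real (m5 / (l2 - l3))))
        + axis 3 (of_real (if l2 = l3 then m5 else 0))"
  unfolding M_def by (auto simp: mat3_simps arrow_mat_def field_simps)

lemma matrix_exp_arrow_mat:
  "matrix_exp (arrow_mat l1 l2 l3 m4 m5) =
     arrow_mat (exp l1) (exp l2) (exp l3)
       (if l1 = l3 then m4 * exp l1 else m4 * ((exp l1 - exp l3) / (l1 - l3)))
       (if l2 = l3 then m5 * exp l2 else m5 * ((exp l2 - exp l3) / (l2 - l3)))"
proof -
  let ?L = "arrow_mat l1 l2 l3 m4 m5"
  let ?E = "matrix_exp ?L"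
  have id: "map_matrix of_real A = A" for A :: "real ^ 3 ^ 3"
    by (simp add: vec_eq_iff)
  note eig = arrow_mat_generalized_eigenvectors[of l1 l2 l3 m4 m5, where 'a = real,
      unfolded id, simplified of_real_eq_id id_apply]
  note gen = matrix_exp_generalized_eigenvector[where 'a = real and A = ?L, unfolded id]
  have E3: "?E *v axis 3 1 = exp l3 *s (axis 3 1 + 0)"
    by (rule gen) (simp_all add: eig(1))
  \<comment> \<open>The last summand is nonzero only if \<open>l1 = l3\<close>, so it satisfies the
    eigenvector equation for \<open>l1\<close> in either case.\<close>
  have E1: "?E *v (axis 1 1 + axis 3 (m4 / (l1 - l3))) =
      exp l1 *s (axis 1 1 + axis 3 (m4 / (l1 - l3)) + axis 3 (if l1 = l3 then m4 else 0))"
    by (rule gen) (rule eig(2), subst eig(1), simp add: vec_eq_iff axis_def)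
  have E2: "?E *v (axis 2 1 + axis 3 (m5 / (l2 - l3))) =
      exp l2 *s (axis 2 1 + axis 3 (m5 / (l2 - l3)) + axis 3 (if l2 = l3 then m5 else 0))"
    by (rule gen) (rule eig(3), subst eig(1), simp add: vec_eq_iff axis_def)
  show ?thesis
    using E1 E2 E3 by (auto simp: mat3_simps arrow_mat_def field_simps split: if_splits)
qed

lemma matrix_log_exp_arrow_mat:
  "matrix_log (matrix_exp (arrow_mat l1 l2 l3 m4 m5)) = arrow_mat l1 l2 l3 m4 m5"
  unfolding matrix_log_def
proof (rule the_equality)
  let ?L = "arrow_mat l1 l2 l3 m4 m5"
  show "matrix_exp ?L = matrix_exp ?L \<and> (\<forall>z. complex_eigenvalue ?L z \<longrightarrow> - pi < Im z \<and> Im z < pi)"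
    by (auto dest: complex_eigenvalue_arrow_mat)
  fix X
  assume "matrix_exp X = matrix_exp ?L \<and> (\<forall>z. complex_eigenvalue X z \<longrightarrow> - pi < Im z \<and> Im z < pi)"
  then have exp_eq: "matrix_exp X = matrix_exp ?L"
    and strip: "\<forall>z. complex_eigenvalue X z \<longrightarrow> - pi < Im z \<and> Im z < pi"
    by auto
  let ?X = "map_matrix complex_of_real X" and ?M = "map_matrix complex_of_real ?L"
  have agree: "?X *v u = ?M *v u"
    if "?M *v u = complex_of_real l *s u + w" "?M *v w = complex_of_real l *s w" for u w l
    using generalized_eigenvector_of_matrix_exp[OF strip _ _ exp_eq that] that(1) by simp
  note eig = arrow_mat_generalized_eigenvectors[of l1 l2 l3 m4 m5, where 'a = complex]
  \<comment> \<open>The scalar \<open>c\<close> stays free so that the corrections along the third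
    axis cancel below.\<close>
  have e3: "?X *v axis 3 c = ?M *v axis 3 c" for c
    by (rule agree[where w = 0 and l = l3]) (simp_all add: eig(1))
  have "?X *v (axis 1 1 + axis 3 (of_real (m4 / (l1 - l3)))) =
      ?M *v (axis 1 1 + axis 3 (of_real (m4 / (l1 - l3))))"
    by (rule agree, rule eig(2), subst eig(1), simp add: vec_eq_iff axis_def)
  then have e1: "?X *v axis 1 1 = ?M *v axis 1 1"
    by (simp only: matrix_vector_right_distrib e3 add_right_cancel)
  have "?X *v (axis 2 1 + axis 3 (of_real (m5 / (l2 - l3)))) =
      ?M *v (axis 2 1 + axis 3 (of_real (m5 / (l2 - l3))))"
    by (rule agree, rule eig(3), subst eig(1), simp add: vec_eq_iff axis_def)
  then have e2: "?X *v axis 2 1 = ?M *v axis 2 1"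
    by (simp only: matrix_vector_right_distrib e3 add_right_cancel)
  have "?X *v axis j 1 = ?M *v axis j 1" for j
    using e1 e2 e3 exhaust_3[of j] by auto
  then have "complex_of_real (X $ i $ j) = complex_of_real (?L $ i $ j)" for i j
    by (simp add: vec_eq_iff matrix_vector_mult_def axis_def if_distrib cong: if_cong)
  then show "X = ?L"
    by (simp add: vec_eq_iff)
qed

section \<open>Lower parts and Cholesky factors in coordinates\<close>

lemma lower_part_V_mat:
  "lower_part (V_mat v1 v2 v3 v4 v5) = arrow_mat (v1 / 2) (v2 / 2) (v3 / 2) v4 v5"
  unfolding lower_part_def
  by (rule the_equality) (auto simp: lower_triangular_def V_mat_def arrow_mat_def mat3_simps)

lemma arrow_mat_mult_transpose:
  "arrow_mat a1 a2 a3 b4 b5 ** transpose (arrow_mat a1 a2 a3 b4 b5) =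
     V_mat (a1\<^sup>2) (a2\<^sup>2) (b4\<^sup>2 + b5\<^sup>2 + a3\<^sup>2) (a1 * b4) (a2 * b5)"
  by (simp add: arrow_mat_def V_mat_def mat3_simps power2_eq_square)

text \<open>The entries of a factor are forced in turn: two positive roots, then the last row by
  division, then the corner as a positive root.\<close>

lemma cholesky_arrow_mat:
  assumes "a1 > 0" "a2 > 0" "a3 > 0"
  shows "cholesky (V_mat (a1\<^sup>2) (a2\<^sup>2) (b4\<^sup>2 + b5\<^sup>2 + a3\<^sup>2) (a1 * b4) (a2 * b5)) =
    arrow_mat a1 a2 a3 b4 b5"
  unfolding cholesky_def
proof (rule the_equality, intro conjI)
  show "arrow_mat a1 a2 a3 b4 b5 \<in> H_group"
    using assms by (simp add: H_group_def lower_triangular_def arrow_mat_def mat3_simps)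
next
  fix T
  assume "T \<in> H_group \<and>
    V_mat (a1\<^sup>2) (a2\<^sup>2) (b4\<^sup>2 + b5\<^sup>2 + a3\<^sup>2) (a1 * b4) (a2 * b5) = T ** transpose T"
  then have H: "T $ 1 $ 2 = 0" "T $ 1 $ 3 = 0" "T $ 2 $ 3 = 0" "T $ 2 $ 1 = 0"
      "T $ 1 $ 1 > 0" "T $ 2 $ 2 > 0" "T $ 3 $ 3 > 0"
    and eq: "V_mat (a1\<^sup>2) (a2\<^sup>2) (b4\<^sup>2 + b5\<^sup>2 + a3\<^sup>2) (a1 * b4) (a2 * b5) = T ** transpose T"
    by (auto simp: H_group_def lower_triangular_def)
  have "(T $ 1 $ 1)\<^sup>2 = a1\<^sup>2" "(T $ 2 $ 2)\<^sup>2 = a2\<^sup>2"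
    using eq H by (simp_all add: V_mat_def mat3_simps power2_eq_square)
  then have T12: "T $ 1 $ 1 = a1" "T $ 2 $ 2 = a2"
    using H assms by (simp_all add: power2_eq_iff_nonneg)
  then have T3: "T $ 3 $ 1 = b4" "T $ 3 $ 2 = b5"
    using eq H assms by (simp_all add: V_mat_def mat3_simps)
  then have "(T $ 3 $ 3)\<^sup>2 = a3\<^sup>2"
    using eq H by (simp add: V_mat_def mat3_simps power2_eq_square)
  then have "T $ 3 $ 3 = a3"
    using H assms by (simp add: power2_eq_iff_nonneg)
  with H T12 T3 show "T = arrow_mat a1 a2 a3 b4 b5"
    by (simp add: arrow_mat_def mat3_simps)
qed (simp add: arrow_mat_mult_transpose)

lemma V_mat_Omega_pos:
  assumes "V_mat x1 x2 x3 x4 x5 \<in> Omega"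
  shows "x1 > 0" and "x2 > 0" and "x3 - x4\<^sup>2 / x1 - x5\<^sup>2 / x2 > 0"
proof -
  let ?x = "V_mat x1 x2 x3 x4 x5"
  have pos: "u \<bullet> (?x *v u) > 0" if "u \<noteq> 0" for u
    using assms that by (simp add: Omega_def pos_def_matrix_def)
  have "axis 1 (1 :: real) \<noteq> (0 :: real ^ 3)" "axis 2 (1 :: real) \<noteq> (0 :: real ^ 3)"
    by simp_all
  from this[THEN pos] show x1: "x1 > 0" and x2: "x2 > 0"
    by (simp_all add: inner_vec_def V_mat_def mat3_simps)
  \<comment> \<open>Completing the squares gives this minimizer of the quadratic form on vectors
    with last entry 1; its value is the Schur complement.\<close>
  let ?u = "vector [- x4 / x1, - x5 / x2, 1] :: real ^ 3"
  have "?u \<noteq> 0"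
    by (simp add: mat3_simps)
  then have "?u \<bullet> (?x *v ?u) > 0"
    by (rule pos)
  also have "?u \<bullet> (?x *v ?u) = x3 - x4\<^sup>2 / x1 - x5\<^sup>2 / x2"
    using x1 x2 by (simp add: inner_vec_def V_mat_def mat3_simps power2_eq_square)
  finally show "x3 - x4\<^sup>2 / x1 - x5\<^sup>2 / x2 > 0" .
qed

section \<open>Closed forms of the clan exponential and logarithm\<close>

lemma clan_Exp_V_mat:
  "clan_Exp (V_mat v1 v2 v3 v4 v5) =
    (let a1 = exp (v1 / 2); a2 = exp (v2 / 2); a3 = exp (v3 / 2);
         b4 = (if v1 \<noteq> v3 then 2 * v4 * ((a1 - a3) / (v1 - v3)) else v4 * a1);
         b5 = (if v2 \<noteq> v3 then 2 * v5 * ((a2 - a3) / (v2 - v3)) else v5 * a2)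
     in V_mat (a1\<^sup>2) (a2\<^sup>2) (b4\<^sup>2 + b5\<^sup>2 + a3\<^sup>2) (a1 * b4) (a2 * b5))"
proof -
  \<comment> \<open>The halved diagonal of the lower part is the source of the factor 2.\<close>
  have half: "m * (a / (s / 2 - t / 2)) = 2 * m * (a / (s - t))" for m a s t :: real
    by (simp add: diff_divide_distrib [symmetric])
  show ?thesis
    unfolding clan_Exp_def lower_part_V_mat matrix_exp_arrow_mat half arrow_mat_mult_transpose
    by (simp add: Let_def)
qed

text \<open>The divided difference of \<open>exp\<close> at \<open>ln a\<close>, \<open>ln c\<close>
  is the reciprocal of that of \<open>ln\<close> at \<open>a\<close>, \<open>c\<close>. Hence the
  proposed entry of the logarithm exponentiates to the Cholesky entry \<open>x / a\<close>.\<close>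

lemma exp_divided_difference_ln:
  fixes a c x :: real
  assumes "a > 0" "c > 0"
  defines "m \<equiv> (if a \<noteq> c then x / a * (ln (a / c) / (a - c)) else x / a\<^sup>2)"
  shows "(if ln a = ln c then m * a else m * ((a - c) / (ln a - ln c))) = x / a"
proof (cases "a = c")
  case True
  then show ?thesis
    using assms(1) by (simp add: m_def power2_eq_square)
next
  case False
  then have "ln a - ln c \<noteq> 0" "a - c \<noteq> 0"
    using assms(1,2) by simp_all
  then show ?thesis
    using assms(1,2) by (simp add: m_def ln_div)
qed

lemma clan_Log_V_mat:
  assumes "V_mat x1 x2 x3 x4 x5 \<in> Omega"
  defines "S \<equiv> x3 - x4\<^sup>2 / x1 - x5\<^sup>2 / x2"
  shows "clan_Log (V_mat x1 x2 x3 x4 x5) =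
     V_mat (ln x1) (ln x2) (ln S)
       (if sqrt x1 \<noteq> sqrt S then x4 / sqrt x1 * (ln (sqrt x1 / sqrt S) / (sqrt x1 - sqrt S)) else x4 / x1)
       (if sqrt x2 \<noteq> sqrt S then x5 / sqrt x2 * (ln (sqrt x2 / sqrt S) / (sqrt x2 - sqrt S)) else x5 / x2)"
    (is "_ = V_mat _ _ _ ?v4 ?v5")
proof -
  have pos: "x1 > 0" "x2 > 0" "S > 0"
    using V_mat_Omega_pos[OF assms(1)] by (simp_all add: S_def)
  define a1 a2 a3 where a: "a1 = sqrt x1" "a2 = sqrt x2" "a3 = sqrt S"
  have apos: "a1 > 0" "a2 > 0" "a3 > 0"
    using pos by (simp_all add: a)
  have x: "x1 = a1\<^sup>2" "x2 = a2\<^sup>2" "S = a3\<^sup>2"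
    using pos by (simp_all add: a)
  \<comment> \<open>The candidate is read off the claimed formula; once its exponential is the
    Cholesky factor, \<open>matrix_log_exp_arrow_mat\<close> identifies it as the logarithm.\<close>
  define L where "L = arrow_mat (ln a1) (ln a2) (ln a3) ?v4 ?v5"
  have m4: "(if ln a1 = ln a3 then ?v4 * exp (ln a1)
      else ?v4 * ((exp (ln a1) - exp (ln a3)) / (ln a1 - ln a3))) = x4 / a1"
    using exp_divided_difference_ln[OF apos(1,3), of x4] apos
    unfolding a[symmetric] unfolding x(1) by (simp only: exp_ln)
  have m5: "(if ln a2 = ln a3 then ?v5 * exp (ln a2)
      else ?v5 * ((exp (ln a2) - exp (ln a3)) / (ln a2 - ln a3))) = x5 / a2"
    using exp_divided_difference_ln[OF apos(2,3), of x5] apos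
    unfolding a[symmetric] unfolding x(2) by (simp only: exp_ln)
  have exp_L: "matrix_exp L = arrow_mat a1 a2 a3 (x4 / a1) (x5 / a2)"
    unfolding L_def matrix_exp_arrow_mat m4 m5 using apos by simp
  have "V_mat x1 x2 x3 x4 x5 =
      V_mat (a1\<^sup>2) (a2\<^sup>2) ((x4 / a1)\<^sup>2 + (x5 / a2)\<^sup>2 + a3\<^sup>2) (a1 * (x4 / a1)) (a2 * (x5 / a2))"
    using apos x(1,2) unfolding x(3)[symmetric] S_def by (simp add: power_divide)
  then have "cholesky (V_mat x1 x2 x3 x4 x5) = matrix_exp L"
    by (simp only: exp_L cholesky_arrow_mat[OF apos])
  then have "clan_Log (V_mat x1 x2 x3 x4 x5) = L + transpose L"
    by (simp add: clan_Log_def L_def matrix_log_exp_arrow_mat)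
  also have "\<dots> = V_mat (2 * ln a1) (2 * ln a2) (2 * ln a3) ?v4 ?v5"
    by (simp add: L_def arrow_mat_def V_mat_def mat3_simps)
  also have "\<dots> = V_mat (ln x1) (ln x2) (ln S) ?v4 ?v5"
    using pos by (simp add: a ln_sqrt)
  finally show ?thesis .
qed

theorem proposition3p4:
  fixes x1 x2 x3 x4 x5 v1 v2 v3 v4 v5 :: real
  shows
    "(V_mat x1 x2 x3 x4 x5 \<in> Omega \<longrightarrow>
       (let S = x3 - x4\<^sup>2 / x1 - x5\<^sup>2 / x2;
            a1 = sqrt x1; a2 = sqrt x2; a3 = sqrt S
        in S > 0 \<and>
           clan_Log (V_mat x1 x2 x3 x4 x5) =
             V_mat (ln x1) (ln x2) (ln S)
               (if a1 \<noteq> a3 then x4 / sqrt x1 * (ln (a1 / a3) / (a1 - a3)) else x4 / x1)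
               (if a2 \<noteq> a3 then x5 / sqrt x2 * (ln (a2 / a3) / (a2 - a3)) else x5 / x2)))
     \<and>
     (let a1 = exp (v1 / 2); a2 = exp (v2 / 2); a3 = exp (v3 / 2);
          b4 = (if v1 \<noteq> v3 then 2 * v4 * ((a1 - a3) / (v1 - v3)) else v4 * a1);
          b5 = (if v2 \<noteq> v3 then 2 * v5 * ((a2 - a3) / (v2 - v3)) else v5 * a2)
      in clan_Exp (V_mat v1 v2 v3 v4 v5) =
           vector [vector [a1\<^sup>2, 0, a1 * b4],
                   vector [0, a2\<^sup>2, a2 * b5],
                   vector [a1 * b4, a2 * b5, b4\<^sup>2 + b5\<^sup>2 + a3\<^sup>2]])"
  using V_mat_Omega_pos(3) clan_Log_V_mat clan_Exp_V_mat[of v1 v2 v3 v4 v5]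
  by (simp add: Let_def V_mat_def)

end
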